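(* Let $p$ be a prime and let $\mathrm{G}=(\mathrm{V},\mathrm{E})$ be a digraph with $\mathrm{V}=\{v_1,\dots,v_n\}$ and directly observable vertices $v_1,\dots,v_h$. Let $\hat{\mathrm{G}}=(\hat{\mathrm{V}},\hat{\mathrm{E}})$ be the auxiliary digraph with $\hat{\mathrm{V}}=\mathrm{V}\cup\{v_1^-,\dots,v_h^-\}$ (new vertices) and $\hat{\mathrm{E}}=\mathrm{E}\cup\{(v_1,v_1^-),\dots,(v_h,v_h^-)\}$. If the minimum number of paths in a vertex-disjoint path cover of $\hat{\mathrm{G}}$ equals $h$, then the finite-field network with interaction digraph $\mathrm{G}$ is structurally observable: there exists a matrix $A=(a_{ij})\in\mathbb{F}_p^{n\times n}$ with $a_{ij}=0$ whenever $(v_j,v_i)\notin\mathrm{E}$ such that the network $x[k+1]=Ax[k]$, $y_j[k]=x_j[k]$ ($j=1,\dots,h$) over $\mathbb{F}_p$ is observable.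
   Context: All operations are in the finite field $\mathbb{F}_p$; $x[k]\in\mathbb{F}_p^n$, $k=0,1,2,\dots$. The network is observable if for any two different initial states at $k=0$ the output sequences differ at some time $k\ge 0$. A vertex-disjoint path cover of a digraph is a set of pairwise vertex-disjoint directed paths (each with distinct vertices; a single vertex is a path) whose vertex sets together cover all vertices. Weights on edges of $\mathrm{G}$ are allowed to be zero. *)

theory Defs
  imports
    "Graph_Theory.Vertex_Walk"
    "Graph_Theory.Pair_Digraph"
    "Jordan_Normal_Form.Matrix"
    "Berlekamp_Zassenhaus.Finite_Field"
begin

text \<open>
  The field with p elements is the type \<^typ>\<open>'p mod_ring\<close> for \<^typ>\<open>'p\<close> of class
  \<^class>\<open>prime_card\<close>, where p is the cardinality of \<^typ>\<open>'p\<close>. Vertices, state components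
  and matrix indices are numbered from 0, as in the matrix library: the vertices are
  v 0, ..., v (n - 1) and the directly observable ones are v 0, ..., v (h - 1).
\<close>

definition vertex_disjoint_path_cover :: "('a, 'b) pre_digraph \<Rightarrow> 'a list set \<Rightarrow> bool" where
  "vertex_disjoint_path_cover G P \<longleftrightarrow>
     finite P \<and> (\<forall>q\<in>P. vpath q G) \<and>
     pairwise (\<lambda>q r. disjnt (set q) (set r)) P \<and> (\<Union>q\<in>P. set q) = verts G"

text \<open>
  For finite digraphs the set of sizes below is nonempty (take all single vertices), so
  the least element is attained.
\<close>

definition min_path_cover_number :: "('a, 'b) pre_digraph \<Rightarrow> nat" where
  "min_path_cover_number G = (LEAST m. \<exists>P. vertex_disjoint_path_cover G P \<and> card P = m)"

text \<open>\<^term>\<open>Inl (v j)\<close> is the original vertex and \<^term>\<open>Inr j\<close> the new vertex attached to it.\<close>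

definition auxiliary_digraph ::
  "'v pair_pre_digraph \<Rightarrow> (nat \<Rightarrow> 'v) \<Rightarrow> nat \<Rightarrow> ('v + nat) pair_pre_digraph" where
  "auxiliary_digraph G v h =
     \<lparr> pverts = Inl ` pverts G \<union> Inr ` {0..<h},
       parcs = map_prod Inl Inl ` parcs G \<union> {(Inl (v j), Inr j) | j. j < h} \<rparr>"

primrec state_seq :: "'a :: semiring_0 mat \<Rightarrow> 'a vec \<Rightarrow> nat \<Rightarrow> 'a vec" where
  "state_seq A x0 0 = x0"
| "state_seq A x0 (Suc k) = A *\<^sub>v state_seq A x0 k"

definition output_seq :: "nat \<Rightarrow> 'a :: semiring_0 mat \<Rightarrow> 'a vec \<Rightarrow> nat \<Rightarrow> 'a vec" where
  "output_seq h A x0 k = vec h (\<lambda>j. state_seq A x0 k $ j)"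

definition observable_network :: "nat \<Rightarrow> nat \<Rightarrow> 'a :: semiring_0 mat \<Rightarrow> bool" where
  "observable_network n h A \<longleftrightarrow>
     (\<forall>x0\<in>carrier_vec n. \<forall>x0'\<in>carrier_vec n.
        x0 \<noteq> x0' \<longrightarrow> (\<exists>k. output_seq h A x0 k \<noteq> output_seq h A x0' k))"

text \<open>
  Row i, column j of the matrix is the weight of the arc from v j to v i; arcs may have
  weight zero.
\<close>

definition compatible_matrix ::
  "'v pair_pre_digraph \<Rightarrow> (nat \<Rightarrow> 'v) \<Rightarrow> nat \<Rightarrow> 'a :: zero mat \<Rightarrow> bool" where
  "compatible_matrix G v n A \<longleftrightarrow>
     A \<in> carrier_mat n n \<and>
     (\<forall>i<n. \<forall>j<n. (v j, v i) \<notin> parcs G \<longrightarrow> A $$ (i, j) = 0)"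

definition structurally_observable ::
  "'p :: prime_card itself \<Rightarrow> 'v pair_pre_digraph \<Rightarrow> (nat \<Rightarrow> 'v) \<Rightarrow> nat \<Rightarrow> nat \<Rightarrow> bool" where
  "structurally_observable _ G v n h \<longleftrightarrow>
     (\<exists>A :: 'p mod_ring mat. compatible_matrix G v n A \<and> observable_network n h A)"

end

theory Submission
  imports Defs
begin

text \<open>
  The new vertices have no outgoing arcs, so each of them is the last vertex of its path. As there
  are h of them, a cover by h paths has every path ending in a new vertex, and the path reaches it
  from an observable vertex. Give weight 1 to the arcs of \<^term>\<open>G\<close> used by the cover and weight 0
  to the others. Every state component that is not the start of a path then copies its predecessor
  on the path, so each initial component is shifted along its path and eventually shows up,
  unchanged, in an output.
\<close>

lemma vwalk_arcs_in_setD: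
  assumes "(a, b) \<in> set (vwalk_arcs q)"
  shows "\<exists>xs ys. q = xs @ a # b # ys"
  using assms
proof (induction q rule: vwalk_arcs.induct)
  case (3 x y xs)
  show ?case
  proof (cases "(a, b) = (x, y)")
    case True
    then have "x # y # xs = [] @ a # b # xs" by simp
    then show ?thesis by blast
  next
    case False
    with 3 obtain us ys where "y # xs = us @ a # b # ys" by auto
    then have "x # y # xs = (x # us) @ a # b # ys" by simp
    then show ?thesis by blast
  qed
qed simp_all

text \<open>\<open>c\<close> occurs only once in \<open>q\<close>, so \<open>q\<close> splits around
  \<open>c\<close> in only one way, and the predecessor is the last entry before the split.\<close>

lemma distinct_vwalk_arcs_pred_unique:
  assumes "distinct q" "(a, c) \<in> set (vwalk_arcs q)" "(b, c) \<in> set (vwalk_arcs q)"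
  shows "a = b"
proof -
  obtain us us' where us: "q = us @ a # c # us'"
    using vwalk_arcs_in_setD[OF assms(2)] by blast
  obtain ws ws' where ws: "q = ws @ b # c # ws'"
    using vwalk_arcs_in_setD[OF assms(3)] by blast
  have "(us @ [a]) @ c # us' = (ws @ [b]) @ c # ws'" "c \<notin> set (us @ [a])" "c \<notin> set us'"
    using us ws assms(1) by auto
  then have "us @ [a] = ws @ [b]"
    by (metis append_Cons_eq_iff)
  then show ?thesis by simp
qed

definition cover_arcs :: "'a list set \<Rightarrow> ('a \<times> 'a) set" where
  "cover_arcs P = (\<Union>q\<in>P. set (vwalk_arcs q))"

text \<open>By disjointness both arcs lie on the one path through \<open>c\<close>. This is what
  leaves at most one nonzero entry in each row of the weight matrix.\<close>

lemma cover_arcs_pred_unique: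
  assumes P: "vertex_disjoint_path_cover G P"
    and ac: "(a, c) \<in> cover_arcs P" and bc: "(b, c) \<in> cover_arcs P"
  shows "a = b"
proof -
  obtain q r where q: "q \<in> P" "(a, c) \<in> set (vwalk_arcs q)"
    and r: "r \<in> P" "(b, c) \<in> set (vwalk_arcs r)"
    using ac bc by (auto simp: cover_arcs_def)
  have "c \<in> set q" "c \<in> set r"
    using vwalk_arcs_in_setD[OF q(2)] vwalk_arcs_in_setD[OF r(2)] by auto
  then have "\<not> disjnt (set q) (set r)"
    by (auto simp: disjnt_iff)
  then have "q = r"
    using P q(1) r(1) unfolding vertex_disjoint_path_cover_def pairwise_def by blast
  moreover have "distinct q"
    using P q(1) by (auto simp: vertex_disjoint_path_cover_def)
  ultimately show ?thesis
    using q(2) r(2) distinct_vwalk_arcs_pred_unique by metis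
qed

lemma min_path_cover_attained:
  assumes "finite (verts G)"
  shows "\<exists>P. vertex_disjoint_path_cover G P \<and> card P = min_path_cover_number G"
  unfolding min_path_cover_number_def
proof (rule LeastI_ex)
  have "vertex_disjoint_path_cover G ((\<lambda>x. [x]) ` verts G)"
    using assms
    by (auto simp: vertex_disjoint_path_cover_def vpath_def vwalk_def pairwise_def disjnt_iff)
  then show "\<exists>m P. vertex_disjoint_path_cover G P \<and> card P = m" by blast
qed

text \<open>A vertex following \<open>s\<close> on the walk would be the head of an arc out of
  \<open>s\<close>.\<close>

lemma vwalk_sink_last:
  assumes "vwalk q G" "s \<in> set q" "\<And>b. (s, b) \<notin> arcs_ends G"
  shows "last q = s"
proof -
  obtain xs ys where q: "q = xs @ s # ys"
    using split_list[OF assms(2)] by blast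
  have "ys = []"
  proof (rule ccontr)
    assume "ys \<noteq> []"
    then obtain b zs where "ys = b # zs" by (cases ys) auto
    then have "(s, b) \<in> set (vwalk_arcs q)"
      using set_vwalk_arcs_append2[of "s # ys" xs] q by auto
    then show False using assms(1,3) by (auto simp: vwalk_def)
  qed
  with q show ?thesis by simp
qed

text \<open>Each sink ends the path through it, so \<open>S\<close> lies in the set of last
  vertices. That set has at most \<open>card P = card S\<close> elements, so the two sets
  coincide.\<close>

lemma path_cover_last_in_sinks:
  assumes P: "vertex_disjoint_path_cover G P"
    and S: "S \<subseteq> verts G" "\<And>s b. s \<in> S \<Longrightarrow> (s, b) \<notin> arcs_ends G"
    and card: "card P = card S"
    and q: "q \<in> P"
  shows "last q \<in> S"
proof -
  have fin: "finite P" using P by (simp add: vertex_disjoint_path_cover_def)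
  have "S \<subseteq> last ` P"
  proof
    fix s assume s: "s \<in> S"
    then obtain r where r: "r \<in> P" "s \<in> set r"
      using P S(1) unfolding vertex_disjoint_path_cover_def by blast
    then have "vwalk r G" using P by (auto simp: vertex_disjoint_path_cover_def)
    then have "last r = s" using vwalk_sink_last r(2) S(2)[OF s] by metis
    then show "s \<in> last ` P" using r(1) by auto
  qed
  moreover have "card (last ` P) \<le> card S"
    using card_image_le[OF fin] card by metis
  ultimately have "last ` P = S"
    using fin by (metis card_seteq finite_imageI)
  then show ?thesis using q by blast
qed

text \<open>A transposed adjacency matrix, as column \<open>j\<close> feeds row \<open>i\<close>.
  Arcs with an end outside \<open>f 0\<close>, ..., \<open>f (n - 1)\<close> are dropped; below
  these are the arcs into the new vertices.\<close>

definition arc_matrix :: "nat \<Rightarrow> (nat \<Rightarrow> 'b) \<Rightarrow> ('b \<times> 'b) set \<Rightarrow> 'a :: semiring_1 mat" where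
  "arc_matrix n f L = mat n n (\<lambda>(i, j). if (f j, f i) \<in> L then 1 else 0)"

lemma arc_matrix_carrier: "arc_matrix n f L \<in> carrier_mat n n"
  by (simp add: arc_matrix_def)

text \<open>A single incoming arc makes row \<open>i\<close> a unit vector.\<close>

lemma arc_matrix_mult_vec_index:
  assumes "x \<in> carrier_vec n" "i < n" "j < n" "(f j, f i) \<in> L"
    and unique: "\<And>k. k < n \<Longrightarrow> (f k, f i) \<in> L \<Longrightarrow> k = j"
  shows "(arc_matrix n f L *\<^sub>v x) $ i = x $ j"
proof -
  have "(arc_matrix n f L *\<^sub>v x) $ i = (\<Sum>k\<in>{0..<n}. (if (f k, f i) \<in> L then 1 else 0) * x $ k)"
    using assms by (simp add: arc_matrix_def scalar_prod_def)
  also have "\<dots> = (\<Sum>k\<in>{0..<n}. if k = j then x $ k else 0)"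
  proof (rule sum.cong[OF refl])
    fix k assume "k \<in> {0..<n}"
    then have "(f k, f i) \<in> L \<longleftrightarrow> k = j"
      using assms(4) unique[of k] by auto
    then show "(if (f k, f i) \<in> L then 1 else 0) * x $ k = (if k = j then x $ k else 0)"
      by simp
  qed
  also have "\<dots> = x $ j"
    using assms(3) by simp
  finally show ?thesis .
qed

text \<open>Lets an induction along a path peel off the first time step, where the recursion of
  \<open>state_seq\<close> peels off the last.\<close>

lemma state_seq_shift: "state_seq A (A *\<^sub>v x) k = state_seq A x (Suc k)"
  by (induction k) auto

text \<open>Induction along the rest of the path. The time \<open>t\<close> and the output
  \<open>j\<close> are chosen before \<open>x\<close>, so the induction hypothesis can be applied to
  the state \<open>A *\<^sub>v x\<close>.\<close>

lemma state_seq_reaches_output: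
  fixes G :: "'v pair_pre_digraph" and v :: "nat \<Rightarrow> 'v" and A :: "'a :: semiring_1 mat"
  assumes G: "pair_fin_digraph G" and v: "bij_betw v {0..<n} (pverts G)" and h: "h \<le> n"
    and unique: "\<And>a b c. (a, c) \<in> L \<Longrightarrow> (b, c) \<in> L \<Longrightarrow> a = b"
    and sub: "L \<subseteq> parcs (auxiliary_digraph G v h)"
    and A: "A = arc_matrix n (Inl \<circ> v) L"
    and i: "i < n"
    and walk: "set (vwalk_arcs (Inl (v i) # ys)) \<subseteq> L" "last (Inl (v i) # ys) \<in> range Inr"
  shows "\<exists>t j. j < h \<and> (\<forall>x\<in>carrier_vec n. state_seq A x t $ j = x $ i)"
  using i walk
proof (induction ys arbitrary: i)
  case Nil
  then show ?case by auto
next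
  case (Cons b ys)
  have inj: "k = l" if "k < n" "l < n" "v k = v l" for k l
    using v that by (auto simp: bij_betw_def inj_on_def)
  have arc: "(Inl (v i), b) \<in> L" using Cons.prems(2) by simp
  then have arc': "(Inl (v i), b) \<in> parcs (auxiliary_digraph G v h)" using sub by blast
  show ?case
  proof (cases b)
    case (Inr j)
    \<comment> \<open>The only arc into the new vertex \<open>Inr j\<close> starts at
      \<open>Inl (v j)\<close>, so component \<open>i\<close> is itself an output, read at time
      0.\<close>
    then have "j < h" "v i = v j" using arc' by (auto simp: auxiliary_digraph_def)
    then have "i = j" using inj h Cons.prems(1) by force
    then have "j < h \<and> (\<forall>x\<in>carrier_vec n. state_seq A x 0 $ j = x $ i)"
      using \<open>j < h\<close> by simp
    then show ?thesis by blast
  next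
    case (Inl u)
    then have "(v i, u) \<in> parcs G" using arc' by (auto simp: auxiliary_digraph_def)
    then have "u \<in> pverts G"
      using G by (meson pair_fin_digraph_def pair_wf_digraph.in_arcsD2)
    then obtain k where k: "k < n" "u = v k"
      using v by (metis atLeastLessThan_iff bij_betw_imp_surj_on imageE)
    then have b: "b = Inl (v k)" using Inl by simp
    have "set (vwalk_arcs (Inl (v k) # ys)) \<subseteq> L" "last (Inl (v k) # ys) \<in> range Inr"
      using Cons.prems(2,3) b by auto
    from Cons.IH[OF k(1) this] obtain t j
      where t: "j < h" "\<And>x. x \<in> carrier_vec n \<Longrightarrow> state_seq A x t $ j = x $ k"
      by blast
    \<comment> \<open>One step moves \<open>x $ i\<close> to component \<open>k\<close>, since the
      arc from \<open>v i\<close> is the only one of \<open>L\<close> into \<open>v k\<close>; after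
      \<open>t\<close> further steps it is at output \<open>j\<close>.\<close>
    have "state_seq A x (Suc t) $ j = x $ i" if x: "x \<in> carrier_vec n" for x
    proof -
      have "A *\<^sub>v x \<in> carrier_vec n"
        unfolding A using mult_mat_vec_carrier[OF arc_matrix_carrier x] .
      then have "state_seq A x (Suc t) $ j = (A *\<^sub>v x) $ k"
        using t(2) state_seq_shift by metis
      also have "\<dots> = x $ i"
        unfolding A
      proof (rule arc_matrix_mult_vec_index[OF x k(1) Cons.prems(1)])
        show "((Inl \<circ> v) i, (Inl \<circ> v) k) \<in> L" using arc b by simp
        fix l assume "l < n" "((Inl \<circ> v) l, (Inl \<circ> v) k) \<in> L"
        then show "l = i"
          using unique[of "Inl (v l)" b "Inl (v i)"] arc b inj Cons.prems(1) by simp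
      qed
      finally show ?thesis .
    qed
    then show ?thesis using t(1) by blast
  qed
qed

lemma observable_networkI:
  fixes A :: "'a :: semiring_1 mat"
  assumes "\<And>i. i < n \<Longrightarrow> \<exists>t j. j < h \<and> (\<forall>x\<in>carrier_vec n. state_seq A x t $ j = x $ i)"
  shows "observable_network n h A"
  unfolding observable_network_def
proof (intro ballI impI, rule ccontr)
  fix x y :: "'a vec"
  assume x: "x \<in> carrier_vec n" and y: "y \<in> carrier_vec n" and "x \<noteq> y"
    and "\<nexists>k. output_seq h A x k \<noteq> output_seq h A y k"
  then have eq: "output_seq h A x k $ j = output_seq h A y k $ j" for k j by simp
  have "x $ i = y $ i" if i: "i < n" for i
  proof -
    obtain t j where t: "j < h" "\<forall>z\<in>carrier_vec n. state_seq A z t $ j = z $ i"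
      using assms[OF i] by blast
    then show ?thesis using x y eq[of t j] by (simp add: output_seq_def)
  qed
  then have "x = y" using x y by (intro eq_vecI) auto
  with \<open>x \<noteq> y\<close> show False by simp
qed

theorem theorem9:
  fixes G :: "'v pair_pre_digraph" and v :: "nat \<Rightarrow> 'v" and n h :: nat
  assumes "pair_fin_digraph G"
    and "bij_betw v {0..<n} (pverts G)"
    and "h \<le> n"
    and "min_path_cover_number (with_proj (auxiliary_digraph G v h)) = h"
  shows "structurally_observable TYPE('p :: prime_card) G v n h"
proof -
  let ?H = "auxiliary_digraph G v h"
  have "finite (pverts G)" using assms(2) bij_betw_finite by blast
  then have "finite (verts (with_proj ?H))" by (simp add: auxiliary_digraph_def)
  then obtain P where P: "vertex_disjoint_path_cover (with_proj ?H) P" and card: "card P = h"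
    using min_path_cover_attained assms(4) by metis
  have path: "vpath q (with_proj ?H)" if "q \<in> P" for q
    using P that by (simp add: vertex_disjoint_path_cover_def)
  have last: "last q \<in> Inr ` {0..<h}" if "q \<in> P" for q
    by (rule path_cover_last_in_sinks[OF P _ _ _ that])
      (auto simp: auxiliary_digraph_def card card_image)
  define L where "L = cover_arcs P"
  have L: "L \<subseteq> parcs ?H"
    using path by (fastforce simp: L_def cover_arcs_def vpath_def vwalk_def)
  have unique: "a = b" if "(a, c) \<in> L" "(b, c) \<in> L" for a b c
    using cover_arcs_pred_unique[OF P] that unfolding L_def .
  define A :: "'p mod_ring mat" where "A = arc_matrix n (Inl \<circ> v) L"
  \<comment> \<open>A nonzero entry comes from an arc of \<open>L\<close> between two
    \<open>Inl\<close> vertices, and such arcs of the auxiliary digraph are arcs of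
    \<open>G\<close>.\<close>
  have "compatible_matrix G v n A"
    using L by (auto simp: compatible_matrix_def A_def arc_matrix_def auxiliary_digraph_def)
  moreover have "observable_network n h A"
  proof (rule observable_networkI)
    fix i assume i: "i < n"
    then have "Inl (v i) \<in> pverts ?H"
      using assms(2) by (auto simp: auxiliary_digraph_def bij_betw_def)
    then obtain q where q: "q \<in> P" "Inl (v i) \<in> set q"
      using P by (auto simp: vertex_disjoint_path_cover_def)
    \<comment> \<open>\<open>v i\<close> may lie in the middle of its path; the suffix from
      \<open>v i\<close> on keeps the last vertex, which is a new one.\<close>
    then obtain xs ys where split: "q = xs @ Inl (v i) # ys"
      using split_list by metis
    have "set (vwalk_arcs (Inl (v i) # ys)) \<subseteq> L"
      using set_vwalk_arcs_append2[of "Inl (v i) # ys" xs] q(1) split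
      unfolding L_def cover_arcs_def by blast
    moreover have "last (Inl (v i) # ys) \<in> range Inr"
      using last[OF q(1)] split by auto
    ultimately show "\<exists>t j. j < h \<and> (\<forall>x\<in>carrier_vec n. state_seq A x t $ j = x $ i)"
      by (intro state_seq_reaches_output[OF assms(1-3) _ L A_def i, where ys = ys])
        (blast intro: unique)
  qed
  ultimately show ?thesis
    unfolding structurally_observable_def by blast
qed

end
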